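(* Fix integers $r\ge 3$ and $k\ge 4$, and let $n\ge 72$. Then \[ F_{r,k}(n)\ \ge\ \frac{n^2}{12}-\frac{10}{3}n . \]
   Context: For a finite set $A\subset\mathbb{R}^2$, a line $\ell$ is called ordinary (for $A$) if $|\ell\cap A|=2$, and $\operatorname{ord}(A)$ denotes the number of ordinary lines of $A$. For integers $r,k\ge 2$ and $n\ge r$, $F_{r,k}(n)$ is defined as the maximum of $\operatorname{ord}(A)$ over all $n$-point sets $A\subset\mathbb{R}^2$ such that (i) every line $\ell$ satisfies $|\ell\cap A|\le k-1$, and (ii) there is no subset $A'\subset A$ with $|A'|=r$ such that every pair of distinct points of $A'$ spans an ordinary line of $A$. If no such set $A$ exists, $F_{r,k}(n):=-1$. *)

theory Defs
  imports "HOL-Analysis.Analysis"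
begin

definition is_line :: "(real ^ 2) set \<Rightarrow> bool" where
  "is_line l \<longleftrightarrow> affine l \<and> aff_dim l = 1"

definition ordinary_line :: "(real ^ 2) set \<Rightarrow> (real ^ 2) set \<Rightarrow> bool" where
  "ordinary_line A l \<longleftrightarrow> is_line l \<and> card (l \<inter> A) = 2"

definition num_ordinary :: "(real ^ 2) set \<Rightarrow> nat" where
  "num_ordinary A = card {l. ordinary_line A l}"

definition admissible :: "nat \<Rightarrow> nat \<Rightarrow> nat \<Rightarrow> (real ^ 2) set \<Rightarrow> bool" where
  "admissible r k n A \<longleftrightarrow>
     finite A \<and> card A = n \<and>
     (\<forall>l. is_line l \<longrightarrow> card (l \<inter> A) \<le> k - 1) \<and>
     \<not> (\<exists>A'\<subseteq>A. card A' = r \<and>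
          (\<forall>p\<in>A'. \<forall>q\<in>A'. p \<noteq> q \<longrightarrow> ordinary_line A (affine hull {p, q})))"

text \<open>The maximum is over a finite set of naturals, see \<open>finite_ordinary_values\<close> below.\<close>

definition F :: "nat \<Rightarrow> nat \<Rightarrow> nat \<Rightarrow> int" where
  "F r k n =
     (if \<exists>A. admissible r k n A
      then int (Max {num_ordinary A | A. admissible r k n A})
      else -1)"

lemma line_eq_hull_of_inter:
  assumes "ordinary_line A l"
  shows "l = affine hull (l \<inter> A)"
proof -
  have l: "affine l" "aff_dim l = 1" and c: "card (l \<inter> A) = 2"
    using assms by (auto simp: ordinary_line_def is_line_def)
  obtain p q where pq: "l \<inter> A = {p, q}" "p \<noteq> q"
    using c by (auto simp: card_2_iff)
  have sub: "affine hull {p, q} \<subseteq> l"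
    using pq l by (intro hull_minimal) auto
  have dim: "aff_dim (affine hull {p, q}) = aff_dim l"
    using pq l by (simp add: aff_dim_2)
  have "affine hull {p, q} = l"
    by (rule affine_dim_equal) (use l sub dim in auto)
  then show ?thesis
    using pq by simp
qed

lemma inj_on_inter_ordinary: "inj_on (\<lambda>l. l \<inter> A) {l. ordinary_line A l}"
  by (rule inj_onI) (metis line_eq_hull_of_inter mem_Collect_eq)

lemma finite_ordinary_lines:
  assumes "finite A"
  shows "finite {l. ordinary_line A l}"
  by (rule inj_on_finite[OF inj_on_inter_ordinary, of A "Pow A"]) (use assms in auto)

lemma num_ordinary_le:
  assumes "finite A"
  shows "num_ordinary A \<le> 2 ^ card A"
  unfolding num_ordinary_def
  using card_inj_on_le[OF inj_on_inter_ordinary, of A "Pow A"] assms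
  by (auto simp: card_Pow)

lemma finite_ordinary_values: "finite {num_ordinary A | A. admissible r k n A}"
  by (rule finite_subset[of _ "{..2 ^ n}"])
     (auto simp: admissible_def dest: num_ordinary_le)

end

theory Submission
  imports Defs
begin

text \<open>
  The points \<open>(tan t, sin t cos t)\<close> lie on a cubic curve on which three distinct points are collinear
  iff their parameters \<open>t\<close> add up to a multiple of \<open>\<pi>\<close>. We take \<open>t = \<pi> j / M\<close> with \<open>M = 7 q\<close> and let
  \<open>j\<close> run over the residues modulo \<open>M\<close> that are not divisible by 7. If \<open>a, b\<close> span an ordinary
  line then \<open>-(a + b)\<close> is divisible by 7 or equal to \<open>a\<close> or \<open>b\<close>, that is, modulo 7 one of \<open>a, b\<close> is
  \<open>-1\<close> or \<open>-2\<close> times the other. Since \<open>-1\<close> and \<open>-2\<close> are both quadratic nonresidues modulo 7, the graph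
  of ordinary pairs is bipartite, while it contains the \<open>3 q\<^sup>2\<close> pairs with \<open>a + b \<equiv> 0 (mod 7)\<close>.
  To reach every cardinality, at most five residues divisible by 7 are added; each of them destroys
  at most \<open>3 q\<close> ordinary pairs.
\<close>

section \<open>Lines in the plane\<close>

lemma mem_affine_hull_2_iff:
  fixes a b c :: "real ^ 2"
  assumes "a $ 1 \<noteq> b $ 1"
  shows "c \<in> affine hull {a, b} \<longleftrightarrow>
    (b $ 1 - a $ 1) * (c $ 2 - a $ 2) = (c $ 1 - a $ 1) * (b $ 2 - a $ 2)"
proof
  assume "c \<in> affine hull {a, b}"
  then obtain u v where c: "c = u *\<^sub>R a + v *\<^sub>R b" and uv: "u + v = 1"
    by (auto simp: affine_hull_2)
  have "u = 1 - v" using uv by simp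
  then show "(b $ 1 - a $ 1) * (c $ 2 - a $ 2) = (c $ 1 - a $ 1) * (b $ 2 - a $ 2)"
    unfolding c \<open>u = 1 - v\<close> by (simp add: algebra_simps)
next
  assume eq: "(b $ 1 - a $ 1) * (c $ 2 - a $ 2) = (c $ 1 - a $ 1) * (b $ 2 - a $ 2)"
  \<comment> \<open>The barycentric coordinate of \<open>c\<close> at \<open>b\<close>, read off the
    first coordinates; the determinant equation makes it fit the second ones too.\<close>
  define v where "v = (c $ 1 - a $ 1) / (b $ 1 - a $ 1)"
  have ne: "b $ 1 - a $ 1 \<noteq> 0" using assms by simp
  have 1: "c $ 1 = (1 - v) * a $ 1 + v * b $ 1"
  proof -
    have "v * (b $ 1 - a $ 1) = c $ 1 - a $ 1" using ne by (simp add: v_def)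
    then show ?thesis by (simp add: algebra_simps)
  qed
  have 2: "c $ 2 = (1 - v) * a $ 2 + v * b $ 2"
  proof -
    have "v * (b $ 2 - a $ 2) = c $ 2 - a $ 2" using ne eq by (simp add: v_def field_simps)
    then show ?thesis by (simp add: algebra_simps)
  qed
  have "c = (1 - v) *\<^sub>R a + v *\<^sub>R b"
    by (simp add: vec_eq_iff forall_2 1 2)
  then show "c \<in> affine hull {a, b}"
    unfolding affine_hull_2 by (smt (verit) mem_Collect_eq)
qed

lemma is_line_affine_hull_2: "p \<noteq> q \<Longrightarrow> is_line (affine hull {p, q})"
  by (simp add: is_line_def aff_dim_2)

lemma is_line_eq_affine_hull:
  assumes "is_line l" "p \<in> l" "q \<in> l" "p \<noteq> q"
  shows "l = affine hull {p, q}"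
proof -
  have "affine hull {p, q} \<subseteq> l"
    using assms by (intro hull_minimal) (auto simp: is_line_def)
  then show ?thesis
    using assms affine_dim_equal[of "affine hull {p, q}" l]
    by (auto simp: is_line_def aff_dim_2)
qed

section \<open>The cubic curve\<close>

text \<open>The bridge from angles to residues: poles, coincidence of points and collinearity all
  become zeros of a sine.\<close>

lemma sin_pi_frac_eq_0_iff:
  fixes M j :: int
  assumes "M \<noteq> 0"
  shows "sin (pi * j / M) = 0 \<longleftrightarrow> M dvd j"
proof -
  have "sin (pi * j / M) = 0 \<longleftrightarrow> (\<exists>i::int. pi * j / M = i * pi)"
    by (simp add: sin_zero_iff_int2)
  also have "\<dots> \<longleftrightarrow> (\<exists>i::int. real_of_int j = real_of_int (M * i))"
    using assms by (auto simp: field_simps)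
  also have "\<dots> \<longleftrightarrow> M dvd j"
    unfolding of_int_eq_iff dvd_def by auto
  finally show ?thesis .
qed

text \<open>A parametrisation of the cubic \<open>y * (1 + x\<^sup>2) = x\<close> by its group law,
  which is addition of angles modulo \<open>pi\<close>. At a zero of the cosine \<open>tan\<close>
  takes the default value 0, so such parameters have to be excluded.\<close>

definition cubic_point :: "real \<Rightarrow> real ^ 2" where
  "cubic_point t = vector [tan t, sin t * cos t]"

lemma cubic_point_nth [simp]:
  "cubic_point t $ 1 = tan t" "cubic_point t $ 2 = sin t * cos t"
  by (simp_all add: cubic_point_def)

lemma sin_mult_cos_eq: "cos t \<noteq> 0 \<Longrightarrow> sin t * cos t = tan t / (1 + (tan t)\<^sup>2)" for t :: real
  by (simp add: tan_sec power2_eq_square tan_def field_simps)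

lemma tan_eq_iff_sin_diff:
  fixes a b :: real
  assumes "cos a \<noteq> 0" "cos b \<noteq> 0"
  shows "tan a = tan b \<longleftrightarrow> sin (a - b) = 0"
  using assms by (auto simp: tan_def sin_diff field_simps)

lemma sin_add3:
  fixes a b c :: real
  assumes "cos a \<noteq> 0" "cos b \<noteq> 0" "cos c \<noteq> 0"
  shows "sin (a + b + c) = cos a * cos b * cos c * (tan a + tan b + tan c - tan a * tan b * tan c)"
  using assms by (simp add: tan_def sin_add cos_add field_simps)

text \<open>The collinearity determinant of three points of the curve is alternating in
  \<open>x\<close>, \<open>y\<close>, \<open>z\<close>, hence contains the Vandermonde factor. The
  cofactor is the numerator in the addition formula for the tangent of a sum of three
  angles.\<close>

lemma cubic_det:
  fixes x y z :: real
  shows "(y - x) * (z / (1 + z\<^sup>2) - x / (1 + x\<^sup>2)) - (z - x) * (y / (1 + y\<^sup>2) - x / (1 + x\<^sup>2)) =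
    (y - x) * (z - x) * (y - z) * (x + y + z - x * y * z) / ((1 + x\<^sup>2) * (1 + y\<^sup>2) * (1 + z\<^sup>2))"
proof -
  have "1 + x\<^sup>2 \<noteq> 0" "1 + y\<^sup>2 \<noteq> 0" "1 + z\<^sup>2 \<noteq> 0"
    by (smt (verit) zero_le_power2)+
  then show ?thesis
    by (simp add: divide_simps) (simp add: algebra_simps power2_eq_square)
qed

lemma cubic_point_collinear_iff:
  assumes "cos a \<noteq> 0" "cos b \<noteq> 0" "cos c \<noteq> 0"
    and "tan a \<noteq> tan b" "tan a \<noteq> tan c" "tan b \<noteq> tan c"
  shows "cubic_point c \<in> affine hull {cubic_point a, cubic_point b} \<longleftrightarrow> sin (a + b + c) = 0"
proof -
  have pos: "1 + (tan x)\<^sup>2 \<noteq> 0" for x :: real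
    by (smt (verit) zero_le_power2)
  have "cubic_point c \<in> affine hull {cubic_point a, cubic_point b} \<longleftrightarrow>
    (tan b - tan a) * (tan c / (1 + (tan c)\<^sup>2) - tan a / (1 + (tan a)\<^sup>2)) -
    (tan c - tan a) * (tan b / (1 + (tan b)\<^sup>2) - tan a / (1 + (tan a)\<^sup>2)) = 0"
    using assms by (subst mem_affine_hull_2_iff) (simp_all add: sin_mult_cos_eq)
  also have "\<dots> \<longleftrightarrow> tan a + tan b + tan c - tan a * tan b * tan c = 0"
    unfolding cubic_det using assms pos by simp
  also have "\<dots> \<longleftrightarrow> sin (a + b + c) = 0"
    using assms by (simp add: sin_add3)
  finally show ?thesis .
qed

section \<open>Finite sets of residues on the cubic\<close>

locale cubic_config =
  fixes M :: int and J :: "int set"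
  assumes M_pos: "M > 0"
    and finite_J: "finite J"
    and incongruent: "a \<in> J \<Longrightarrow> b \<in> J \<Longrightarrow> M dvd a - b \<Longrightarrow> a = b"
    and no_pole: "a \<in> J \<Longrightarrow> \<not> 2 * M dvd 2 * a - M"
begin

definition pt :: "int \<Rightarrow> real ^ 2" where
  "pt j = cubic_point (pi * j / M)"

definition pts :: "(real ^ 2) set" where
  "pts = pt ` J"

text \<open>The exclusion of \<open>a\<close> and \<open>b\<close> accounts for tangency: if
  \<open>-(a + b)\<close> is congruent to \<open>a\<close> or \<open>b\<close>, the line touches the
  cubic there and has no further point.\<close>

definition third :: "int \<Rightarrow> int \<Rightarrow> bool" where
  "third a b \<longleftrightarrow> (\<exists>c\<in>J - {a, b}. M dvd a + b + c)"

text \<open>The cosine vanishes exactly when \<open>a / M - 1 / 2\<close> is an integer;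
  \<open>no_pole\<close> excludes this in a form cleared of fractions, valid for even and odd
  \<open>M\<close>.\<close>

lemma cos_nonzero:
  assumes "a \<in> J"
  shows "cos (pi * a / M) \<noteq> 0"
proof -
  have "cos (pi * a / M) = - sin (pi * a / M - pi / 2)"
    by (simp add: sin_diff)
  also have "pi * a / M - pi / 2 = pi * real_of_int (2 * a - M) / real_of_int (2 * M)"
    using M_pos by (simp add: field_simps)
  finally show ?thesis
    using sin_pi_frac_eq_0_iff[of "2 * M" "2 * a - M"] no_pole[OF assms] M_pos by simp
qed

lemma tan_distinct:
  assumes "a \<in> J" "b \<in> J" "a \<noteq> b"
  shows "tan (pi * a / M) \<noteq> tan (pi * b / M)"
proof -
  have "pi * a / M - pi * b / M = pi * real_of_int (a - b) / M"
    by (simp add: algebra_simps diff_divide_distrib)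
  then show ?thesis
    using assms incongruent M_pos sin_pi_frac_eq_0_iff[of M "a - b"]
    by (auto simp: tan_eq_iff_sin_diff cos_nonzero)
qed

lemma inj_on_pt: "inj_on pt J"
proof (rule inj_onI)
  fix a b assume "a \<in> J" "b \<in> J" "pt a = pt b"
  then show "a = b"
    using tan_distinct[of a b] by (metis cubic_point_nth(1) pt_def)
qed

lemma finite_pts: "finite pts" and card_pts: "card pts = card J"
  using finite_J inj_on_pt by (auto simp: pts_def card_image)

lemma pt_in_hull_iff:
  assumes "a \<in> J" "b \<in> J" "c \<in> J" "a \<noteq> b" "a \<noteq> c" "b \<noteq> c"
  shows "pt c \<in> affine hull {pt a, pt b} \<longleftrightarrow> M dvd a + b + c"
proof -
  have "pi * a / M + pi * b / M + pi * c / M = pi * real_of_int (a + b + c) / M"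
    by (simp add: algebra_simps add_divide_distrib)
  then show ?thesis
    using assms M_pos sin_pi_frac_eq_0_iff[of M "a + b + c"]
    by (simp add: pt_def cubic_point_collinear_iff cos_nonzero tan_distinct)
qed

lemma hull_inter_pts:
  assumes "a \<in> J" "b \<in> J" "a \<noteq> b"
  shows "affine hull {pt a, pt b} \<inter> pts = pt ` ({a, b} \<union> {c \<in> J - {a, b}. M dvd a + b + c})"
  using assms pt_in_hull_iff[OF assms(1,2)] by (auto simp: pts_def hull_inc)

lemma ordinary_iff:
  assumes "a \<in> J" "b \<in> J" "a \<noteq> b"
  shows "ordinary_line pts (affine hull {pt a, pt b}) \<longleftrightarrow> \<not> third a b"
proof -
  let ?C = "{c \<in> J - {a, b}. M dvd a + b + c}"
  have ne: "pt a \<noteq> pt b"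
    using assms inj_on_pt by (auto dest: inj_onD)
  have "card (affine hull {pt a, pt b} \<inter> pts) = card ({a, b} \<union> ?C)"
    unfolding hull_inter_pts[OF assms]
    by (rule card_image) (rule inj_on_subset[OF inj_on_pt], use assms in auto)
  also have "\<dots> = 2 + card ?C"
    using assms finite_J by (subst card_Un_disjoint) auto
  finally show ?thesis
    using finite_J ne by (auto simp: ordinary_line_def third_def is_line_affine_hull_2)
qed

text \<open>Two points on a line determine the residue of any third one: \<open>c\<close> and
  \<open>d\<close> are both congruent to \<open>-(a + b)\<close>, hence equal.\<close>

lemma card_line_inter_pts:
  assumes "is_line l"
  shows "card (l \<inter> pts) \<le> 3"
proof (rule ccontr)
  assume "\<not> card (l \<inter> pts) \<le> 3"
  then have "4 \<le> card (l \<inter> pts)" by simp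
  then obtain X where X: "X \<subseteq> l \<inter> pts" "card X = 4"
    by (meson obtain_subset_with_card_n)
  obtain I where I: "I \<subseteq> J" "X = pt ` I"
    using X(1) by (metis le_inf_iff pts_def subset_imageE)
  have cI: "card I = 4"
    using X(2) I by (metis card_image inj_on_pt inj_on_subset)
  then obtain a B where aB: "I = insert a B" "a \<notin> B" "card B = 3"
    using card_Suc_eq[of I 3] by auto
  then obtain b c d where B: "B = {b, c, d}" "b \<noteq> c" "b \<noteq> d" "c \<noteq> d"
    by (auto simp: card_3_iff)
  have J: "a \<in> J" "b \<in> J" "c \<in> J" "d \<in> J" and ne: "a \<noteq> b" "a \<noteq> c" "a \<noteq> d"
    using I aB B by auto
  have l: "pt a \<in> l" "pt b \<in> l" "pt c \<in> l" "pt d \<in> l"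
    using X I aB B by auto
  have "pt a \<noteq> pt b"
    using J ne inj_on_pt by (auto dest: inj_onD)
  then have "l = affine hull {pt a, pt b}"
    using is_line_eq_affine_hull[OF assms] l by auto
  then have "M dvd a + b + c" "M dvd a + b + d"
    using pt_in_hull_iff J ne B l by blast+
  then have "M dvd (a + b + c) - (a + b + d)"
    by (rule dvd_diff)
  then have "M dvd c - d" by simp
  then show False
    using incongruent J B by blast
qed

text \<open>\<open>f\<close> is a proper 2-colouring of the graph of ordinary pairs. Among
  \<open>r \<ge> 3\<close> points two share a colour, so they cannot be pairwise joined by ordinary
  lines.\<close>

lemma admissible_pts:
  fixes f :: "int \<Rightarrow> bool"
  assumes "r \<ge> 3" "k \<ge> 4"
    and col: "\<And>a b. a \<in> J \<Longrightarrow> b \<in> J \<Longrightarrow> a \<noteq> b \<Longrightarrow> f a = f b \<Longrightarrow> third a b"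
  shows "admissible r k (card J) pts"
  unfolding admissible_def
proof (intro conjI allI impI notI finite_pts card_pts)
  fix l :: "(real ^ 2) set" assume "is_line l"
  then show "card (l \<inter> pts) \<le> k - 1"
    using card_line_inter_pts[of l] \<open>k \<ge> 4\<close> by linarith
next
  assume "\<exists>A'\<subseteq>pts. card A' = r \<and>
    (\<forall>p\<in>A'. \<forall>q\<in>A'. p \<noteq> q \<longrightarrow> ordinary_line pts (affine hull {p, q}))"
  then obtain A' where A': "A' \<subseteq> pts" "card A' = r"
    "\<And>p q. p \<in> A' \<Longrightarrow> q \<in> A' \<Longrightarrow> p \<noteq> q \<Longrightarrow> ordinary_line pts (affine hull {p, q})"
    by blast
  obtain I where I: "I \<subseteq> J" "A' = pt ` I"
    using A'(1) by (metis pts_def subset_imageE)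
  have cI: "card I = r"
    using A'(2) I by (metis card_image inj_on_pt inj_on_subset)
  have "\<not> inj_on f I"
  proof
    assume "inj_on f I"
    then have "card I \<le> card (UNIV :: bool set)"
      by (rule card_inj_on_le) auto
    then show False using cI \<open>r \<ge> 3\<close> by simp
  qed
  then obtain a b where ab: "a \<in> I" "b \<in> I" "a \<noteq> b" "f a = f b"
    by (auto simp: inj_on_def)
  then have J: "a \<in> J" "b \<in> J" using I by auto
  have "pt a \<noteq> pt b"
    using J ab inj_on_pt by (auto dest: inj_onD)
  then have "ordinary_line pts (affine hull {pt a, pt b})"
    using A'(3) ab I by blast
  then show False
    using ordinary_iff J ab col by blast
qed

text \<open>An ordinary line is recovered from its two points in \<open>pts\<close>, and asymmetry
  of \<open>S\<close> lets each unordered pair occur in one order only.\<close>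

lemma card_le_num_ordinary:
  assumes "S \<subseteq> J \<times> J"
    and asym: "\<And>a b. (a, b) \<in> S \<Longrightarrow> (b, a) \<notin> S"
    and ord: "\<And>a b. (a, b) \<in> S \<Longrightarrow> \<not> third a b"
  shows "card S \<le> num_ordinary pts"
  unfolding num_ordinary_def
proof (rule card_inj_on_le[where f = "\<lambda>(a, b). affine hull {pt a, pt b}"])
  have S: "a \<in> J \<and> b \<in> J \<and> a \<noteq> b \<and> \<not> third a b" if "(a, b) \<in> S" for a b
    using that assms by blast
  show "(\<lambda>(a, b). affine hull {pt a, pt b}) ` S \<subseteq> {l. ordinary_line pts l}"
    using S ordinary_iff by auto
  show "finite {l. ordinary_line pts l}"
    by (rule finite_ordinary_lines[OF finite_pts])
  have trace: "affine hull {pt a, pt b} \<inter> pts = pt ` {a, b}" if "(a, b) \<in> S" for a b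
  proof -
    have "{c \<in> J - {a, b}. M dvd a + b + c} = {}"
      using S[OF that] by (auto simp: third_def)
    then show ?thesis
      using hull_inter_pts[of a b] S[OF that] by (metis Un_empty_right)
  qed
  show "inj_on (\<lambda>(a, b). affine hull {pt a, pt b}) S"
  proof (rule inj_onI, clarify)
    fix a b c d
    assume ab: "(a, b) \<in> S" and cd: "(c, d) \<in> S"
      and "affine hull {pt a, pt b} = affine hull {pt c, pt d}"
    then have "pt ` {a, b} = pt ` {c, d}"
      using trace by metis
    then have "{a, b} = {c, d}"
      using inj_on_image_eq_iff[OF inj_on_pt, of "{a, b}" "{c, d}"] S[OF ab] S[OF cd] by blast
    then show "a = c \<and> b = d"
      using ab cd asym by (auto simp: doubleton_eq_iff)
  qed
qed

end

section \<open>Residues modulo 7\<close>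

lemma finite_interval_Collect: "finite {j \<in> {0..<m}. P j}" for m :: int
  by (rule finite_subset[of _ "{0..<m}"]) auto

text \<open>Division with remainder: each residue class meets the interval in \<open>q\<close>
  numbers.\<close>

lemma card_mod_7:
  fixes R :: "int set"
  assumes "R \<subseteq> {0..<7}"
  shows "card {j \<in> {0..<7 * int q}. j mod 7 \<in> R} = q * card R"
proof -
  have "bij_betw (\<lambda>(i, s). 7 * i + s) ({0..<int q} \<times> R) {j \<in> {0..<7 * int q}. j mod 7 \<in> R}"
  proof (rule bij_betwI[where g = "\<lambda>j. (j div 7, j mod 7)"])
    show "(\<lambda>(i, s). 7 * i + s) \<in> {0..<int q} \<times> R \<rightarrow> {j \<in> {0..<7 * int q}. j mod 7 \<in> R}"
      using assms by (fastforce simp: subset_iff)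
    show "(\<lambda>j. (j div 7, j mod 7)) \<in> {j \<in> {0..<7 * int q}. j mod 7 \<in> R} \<rightarrow> {0..<int q} \<times> R"
      by auto
  qed (use assms in \<open>auto simp: subset_iff\<close>)
  from bij_betw_same_card[OF this] show ?thesis
    by (simp add: card_cartesian_product)
qed

section \<open>Residues not divisible by 7, with added multiples of 7\<close>

definition seven_set :: "nat \<Rightarrow> int set \<Rightarrow> int set" where
  "seven_set q E = {j \<in> {0..<7 * int q}. \<not> 7 dvd j} \<union> E"

text \<open>The set \<open>{1, 2, 4}\<close> consists of the quadratic residues modulo 7.\<close>

definition colour :: "int \<Rightarrow> bool" where
  "colour j \<longleftrightarrow> (if 7 dvd j then \<bar>j\<bar> = 14 else j mod 7 \<in> {1, 2, 4})"

text \<open>The colour classes among the candidates are \<open>{0, 7, -7}\<close> and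
  \<open>{14, -14}\<close>. Two equally coloured members need a third one in \<open>E\<close> making
  the sum exactly 0, not just 0 modulo \<open>7 * q\<close>, so the condition does not depend on
  \<open>q\<close>.\<close>

definition filler :: "int set \<Rightarrow> bool" where
  "filler E \<longleftrightarrow> E \<subseteq> {0, 7, -7, 14, -14} \<and>
    (\<forall>a\<in>E. \<forall>b\<in>E. a \<noteq> b \<longrightarrow> colour a = colour b \<longrightarrow> - (a + b) \<in> E - {a, b})"

text \<open>The part without multiples of 7 has \<open>6 * q\<close> elements, so sizes 0 to 5 reach
  every cardinality. The triple \<open>0, 7, -7\<close> sums to 0, and so does
  \<open>14, -14, 0\<close>; size 2 takes one element of each colour.\<close>

lemma filler_exists:
  assumes "m < 6"
  shows "\<exists>E. filler E \<and> card E = m"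
proof -
  have "m \<in> {0, 1, 2, 3, 4, 5}" using assms by auto
  moreover have "filler {} \<and> card ({} :: int set) = 0"
    by (simp add: filler_def)
  moreover have "filler {0} \<and> card {0 :: int} = 1"
    by (simp add: filler_def)
  moreover have "filler {7, 14} \<and> card {7, 14 :: int} = 2"
    by (simp add: filler_def colour_def)
  moreover have "filler {0, 7, -7} \<and> card {0, 7, -7 :: int} = 3"
    by (simp add: filler_def colour_def)
  moreover have "filler {0, 7, -7, 14} \<and> card {0, 7, -7, 14 :: int} = 4"
    by (simp add: filler_def colour_def)
  moreover have "filler {0, 7, -7, 14, -14} \<and> card {0, 7, -7, 14, -14 :: int} = 5"
    by (simp add: filler_def colour_def)
  ultimately show ?thesis by blast
qed

context
  fixes q :: nat and E :: "int set"
  assumes q: "q \<ge> 5" and E: "filler E"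
begin

lemma E_multiple: "e \<in> E \<Longrightarrow> 7 dvd e"
  and E_bound: "e \<in> E \<Longrightarrow> \<bar>e\<bar> \<le> 14"
  and finite_E: "finite E"
  using E by (auto simp: filler_def intro: finite_subset)

lemma finite_seven_set: "finite (seven_set q E)"
  unfolding seven_set_def by (intro finite_UnI finite_interval_Collect finite_E)

lemma seven_multiple: "a \<in> seven_set q E \<Longrightarrow> 7 dvd a \<Longrightarrow> a \<in> E"
  by (auto simp: seven_set_def)

lemma cubic_config_seven: "cubic_config (7 * int q) (seven_set q E)"
proof
  show "7 * int q > 0" using q by simp
  show "finite (seven_set q E)" by (rule finite_seven_set)
next
  fix a b assume a: "a \<in> seven_set q E" and b: "b \<in> seven_set q E" and d: "7 * int q dvd a - b"
  have "7 dvd a - b" using d by (rule dvd_mult_left)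
  then have iff: "7 dvd a \<longleftrightarrow> 7 dvd b" by presburger
  \<comment> \<open>Two fillers differ by at most 28, which is less than \<open>7 * q\<close>
    because \<open>q \<ge> 5\<close>.\<close>
  have "\<bar>a - b\<bar> < 7 * int q"
  proof (cases "7 dvd a")
    case True
    then show ?thesis
      using a b iff seven_multiple E_bound[of a] E_bound[of b] q by fastforce
  next
    case False
    then show ?thesis
      using a b iff E_multiple by (auto simp: seven_set_def)
  qed
  then show "a = b"
    using d zdvd_imp_le[of "7 * int q" "\<bar>a - b\<bar>"] by fastforce
next
  fix a assume a: "a \<in> seven_set q E"
  show "\<not> 2 * (7 * int q) dvd 2 * a - 7 * int q"
  proof
    assume d: "2 * (7 * int q) dvd 2 * a - 7 * int q"
    \<comment> \<open>A pole would be a multiple of 7, hence a filler, but then \<open>2 * a\<close>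
      has absolute value at most 28, too small for the divisibility.\<close>
    have "7 dvd 2 * a - 7 * int q"
      using d by (metis dvd_mult_left mult.left_commute)
    then have "7 dvd a" by presburger
    then have "\<bar>a\<bar> \<le> 14"
      using a seven_multiple E_bound by blast
    then have "0 < 7 * int q - 2 * a" "7 * int q - 2 * a < 2 * (7 * int q)"
      using q by auto
    moreover have "2 * (7 * int q) dvd 7 * int q - 2 * a"
      using d by (metis dvd_minus_iff minus_diff_eq)
    ultimately show False
      using zdvd_imp_le by fastforce
  qed
qed

interpretation cubic_config "7 * int q" "seven_set q E"
  by (rule cubic_config_seven)

text \<open>The three assumptions say that the residue \<open>-(a + b)\<close> is nonzero modulo 7
  and differs there from \<open>a\<close> and from \<open>b\<close>. Its least nonnegative
  representative is then in the set, whatever the fillers are.\<close>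

lemma third_mod_7:
  assumes "\<not> 7 dvd a + b" "\<not> 7 dvd 2 * a + b" "\<not> 7 dvd a + 2 * b"
  shows "third a b"
proof -
  define c where "c = (- (a + b)) mod (7 * int q)"
  have M: "7 * int q dvd a + b + c"
    unfolding c_def by (simp add: mod_eq_0_iff_dvd [symmetric] mod_simps)
  then have "7 dvd a + b + c" by (rule dvd_mult_left)
  then have "\<not> 7 dvd c" "c \<noteq> a" "c \<noteq> b"
    using assms by presburger+
  moreover have "0 \<le> c" "c < 7 * int q"
    using q by (auto simp: c_def)
  ultimately have "c \<in> seven_set q E - {a, b}"
    by (simp add: seven_set_def)
  then show ?thesis
    unfolding third_def using M by blast
qed

lemma third_if_colour_eq:
  assumes "a \<in> seven_set q E" "b \<in> seven_set q E" "a \<noteq> b" "colour a = colour b"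
  shows "third a b"
proof (cases "7 dvd a \<and> 7 dvd b")
  case True
  then have "a \<in> E" "b \<in> E" using assms seven_multiple by auto
  then have "- (a + b) \<in> seven_set q E - {a, b}"
    using E assms by (auto simp: filler_def seven_set_def)
  then show ?thesis
    unfolding third_def by (rule bexI[rotated]) simp
next
  case False
  show ?thesis
  proof (cases "7 dvd a \<or> 7 dvd b")
    case True
    \<comment> \<open>If exactly one of \<open>a\<close>, \<open>b\<close> is a multiple of 7, none
      of the three forms \<open>a + b\<close>, \<open>2 * a + b\<close>, \<open>a + 2 * b\<close>
      is.\<close>
    with False show ?thesis by (intro third_mod_7) presburger+
  next
    case nd: False
    have "a mod 7 \<in> {0..<7}" "b mod 7 \<in> {0..<7}" by auto
    moreover have "{0..<7} = {0, 1, 2, 3, 4, 5, 6 :: int}" by auto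
    ultimately have "a mod 7 \<in> {1, 2, 4} \<and> b mod 7 \<in> {1, 2, 4} \<or>
        a mod 7 \<in> {3, 5, 6} \<and> b mod 7 \<in> {3, 5, 6}"
      using assms(4) nd unfolding colour_def by (auto simp: dvd_eq_mod_eq_0)
    then obtain i j where ij: "a mod 7 = i" "b mod 7 = j"
      and cases: "i \<in> {1, 2, 4} \<and> j \<in> {1, 2, 4} \<or> i \<in> {3, 5, 6} \<and> j \<in> {3, 5, 6}"
      by blast
    \<comment> \<open>Reduces the three forms to the residues \<open>i\<close> and \<open>j\<close>,
      leaving finitely many cases; within one colour class no residue is \<open>-1\<close> or
      \<open>-2\<close> times another.\<close>
    have "7 dvd x * a + y * b \<longleftrightarrow> 7 dvd x * i + y * j" for x y
    proof -
      have "(x * a + y * b) mod 7 = (x * i + y * j) mod 7"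
        unfolding ij[symmetric] by (rule mod_add_cong) (simp_all only: mod_mult_right_eq)
      then show ?thesis by (simp only: dvd_eq_mod_eq_0)
    qed
    from this[of 1 1] this[of 2 1] this[of 1 2] cases show ?thesis
      by (intro third_mod_7) auto
  qed
qed

lemma card_seven_set: "card (seven_set q E) = 6 * q + card E"
proof -
  have "{j \<in> {0..<7 * int q}. \<not> 7 dvd j} = {j \<in> {0..<7 * int q}. j mod 7 \<in> {1..<7}}"
    by (auto simp: dvd_eq_mod_eq_0 order_less_le)
  then have "card {j \<in> {0..<7 * int q}. \<not> 7 dvd j} = 6 * q"
    using card_mod_7[of "{1..<7}" q] by simp
  then show ?thesis
    using finite_seven_set E_multiple unfolding seven_set_def
    by (subst card_Un_disjoint) auto
qed

lemma num_ordinary_seven: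
  "3 * q * q \<le> num_ordinary pts + 3 * q * card E"
proof -
  \<comment> \<open>One residue from each pair \<open>s, -s\<close> modulo 7, so that
    \<open>T\<close> lists each unordered pair with sum divisible by 7 in a single order.\<close>
  define D where "D = {j \<in> {0..<7 * int q}. j mod 7 \<in> {1, 2, 3}}"
  define T where "T = (SIGMA a:D. {b \<in> {0..<7 * int q}. b mod 7 \<in> {(- a) mod 7}})"
  \<comment> \<open>The pairs of \<open>T\<close> whose line may acquire the filler \<open>e\<close>
    as a third point.\<close>
  define B where "B e = {(a, b) \<in> T. 7 * int q dvd a + b + e}" for e
  define S where "S = T - (\<Union>e\<in>E. B e)"
  have finite_D: "finite D"
    unfolding D_def by (rule finite_interval_Collect)
  have card_D: "card D = 3 * q"
    unfolding D_def by (subst card_mod_7) auto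
  have finite_T: "finite T" 
    unfolding T_def by (intro finite_SigmaI finite_D finite_interval_Collect)
  have card_T: "card T = 3 * q * q"
  proof -
    have "card {b \<in> {0..<7 * int q}. b mod 7 \<in> {(- a) mod 7}} = q" for a
      by (subst card_mod_7) auto
    then show ?thesis
      unfolding T_def by (subst card_SigmaI) (use finite_interval_Collect in \<open>simp_all add: finite_D card_D del: Collect_conj_eq insert_iff atLeastLessThan_iff\<close>)
  qed
  have T: "a \<in> {0..<7 * int q} \<and> b \<in> {0..<7 * int q} \<and> 7 dvd a + b \<and> a mod 7 \<in> {1, 2, 3}"
    if "(a, b) \<in> T" for a b
  proof -
    have "a \<in> D" "b \<in> {0..<7 * int q}" "b mod 7 = (- a) mod 7"
      using that unfolding T_def by blast+
    then show ?thesis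
      by (simp add: D_def mod_eq_dvd_iff add.commute)
  qed
  have card_B: "card (B e) \<le> 3 * q" for e
  proof -
    \<comment> \<open>Given \<open>e\<close>, the entry \<open>a\<close> fixes \<open>b\<close>
      modulo \<open>7 * q\<close>, hence in the interval.\<close>
    have "inj_on fst (B e)"
    proof (rule inj_onI, clarsimp)
      fix a b b' assume "(a, b) \<in> B e" "(a, b') \<in> B e"
      then have d: "7 * int q dvd a + b + e" "7 * int q dvd a + b' + e"
        and r: "b \<in> {0..<7 * int q}" "b' \<in> {0..<7 * int q}"
        using T unfolding B_def by blast+
      have "7 * int q dvd (a + b + e) - (a + b' + e)"
        using d by (rule dvd_diff)
      then have "b mod (7 * int q) = b' mod (7 * int q)"
        by (simp add: mod_eq_dvd_iff)
      then show "b = b'" using r by simp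
    qed
    moreover have "fst ` B e \<subseteq> D" by (auto simp: B_def T_def)
    ultimately show ?thesis
      using card_inj_on_le finite_D card_D by metis
  qed
  have "card (\<Union>e\<in>E. B e) \<le> (\<Sum>e\<in>E. card (B e))"
    by (rule card_UN_le[OF finite_E])
  also have "\<dots> \<le> card E * (3 * q)"
    using sum_bounded_above[of E "\<lambda>e. card (B e)" "3 * q"] card_B by simp
  finally have "card (\<Union>e\<in>E. B e) \<le> 3 * q * card E" by (simp add: mult.commute)
  moreover have "card T \<le> card S + card (\<Union>e\<in>E. B e)"
  proof -
    have "(\<Union>e\<in>E. B e) \<subseteq> T" by (auto simp: B_def)
    then have "card T = card (S \<union> (\<Union>e\<in>E. B e))"
      unfolding S_def by (intro arg_cong[where f = card]) blast
    then show ?thesis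
      using card_Un_le[of S "\<Union>e\<in>E. B e"] by simp
  qed
  moreover have "card S \<le> num_ordinary pts"
  proof (rule card_le_num_ordinary)
    show "S \<subseteq> seven_set q E \<times> seven_set q E"
    proof clarify
      fix a b assume "(a, b) \<in> S"
      then have ab: "a \<in> {0..<7 * int q} \<and> b \<in> {0..<7 * int q} \<and> 7 dvd a + b \<and> a mod 7 \<in> {1, 2, 3}"
        using T by (auto simp: S_def)
      then have "\<not> 7 dvd a" by (auto simp: dvd_eq_mod_eq_0)
      moreover from this have "\<not> 7 dvd b"
        using ab dvd_add_left_iff by blast
      ultimately show "a \<in> seven_set q E \<and> b \<in> seven_set q E"
        using ab by (auto simp: seven_set_def)
    qed
  next
    fix a b assume "(a, b) \<in> S"
    then have "7 dvd a + b" "a mod 7 \<in> {1, 2, 3}"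
      using T by (auto simp: S_def)
    then have "b mod 7 \<notin> {1, 2, 3}"
      by (elim insertE emptyE; simp; presburger)
    then show "(b, a) \<notin> S"
      using T by (auto simp: S_def)
  next
    fix a b assume ab: "(a, b) \<in> S"
    show "\<not> third a b"
    proof
      assume "third a b"
      then obtain c where c: "c \<in> seven_set q E" "7 * int q dvd a + b + c"
        by (auto simp: third_def)
      then have "7 dvd a + b + c" by (meson dvd_mult_left)
      moreover have "7 dvd a + b" using ab T by (auto simp: S_def)
      \<comment> \<open>A third point on the line of such a pair is a multiple of 7, hence a filler,
        and the pairs affected by fillers were removed from \<open>S\<close>.\<close>
      ultimately have "7 dvd c" by presburger
      then have "c \<in> E" using c seven_multiple by blast
      then show False using ab c by (auto simp: S_def B_def)
    qed
  qed
  ultimately show ?thesis using card_T by linarith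
qed

lemma admissible_seven:
  assumes "r \<ge> 3" "k \<ge> 4"
  shows "\<exists>A. admissible r k (6 * q + card E) A \<and> 3 * q * q \<le> num_ordinary A + 3 * q * card E"
proof (intro exI conjI)
  show "admissible r k (6 * q + card E) pts"
    using admissible_pts[OF assms, of colour] third_if_colour_eq card_seven_set by simp
qed (rule num_ordinary_seven)

end

section \<open>The lower bound for every cardinality\<close>

lemma F_ge:
  assumes "admissible r k n A"
  shows "F r k n \<ge> int (num_ordinary A)"
  using assms Max_ge[OF finite_ordinary_values, of "num_ordinary A" r k n]
  unfolding F_def by auto

theorem theorem2p1:
  fixes r k n :: nat
  assumes "r \<ge> 3" and "k \<ge> 4" and "n \<ge> r" and "n \<ge> 72"
  shows "real_of_int (F r k n) \<ge> (real n)\<^sup>2 / 12 - (10 / 3) * real n"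
proof -
  define q where "q = n div 6"
  obtain E where E: "filler E" "card E = n mod 6"
    using filler_exists[of "n mod 6"] by auto
  have "q \<ge> 5" using assms by (simp add: q_def)
  moreover have n: "6 * q + card E = n" by (simp add: q_def E)
  ultimately obtain A where A: "admissible r k n A" "3 * q * q \<le> num_ordinary A + 3 * q * card E"
    using admissible_seven[of q E r k] E assms by metis
  define m where "m = real (card E)"
  have m: "0 \<le> m" "m \<le> 5"
    using E by (auto simp: m_def)
  have q_eq: "real q = (real n - m) / 6"
    using n by (auto simp: m_def)
  \<comment> \<open>With \<open>q = (n - m) / 6\<close> the count
    \<open>3 * q * q - 3 * q * m\<close> equals the right-hand side. Its mixed term
    \<open>8 * m * n\<close> is at most \<open>40 * n\<close> since \<open>m \<le> 5\<close>, and 40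
    / 12 is the constant 10 / 3.\<close>
  have "(real n)\<^sup>2 / 12 - (10 / 3) * real n \<le> (real n - m) * (real n - 7 * m) / 12"
  proof -
    have "m * real n \<le> 5 * real n" using m by (intro mult_right_mono) auto
    moreover have "0 \<le> m * m" by simp
    moreover have "(real n - m) * (real n - 7 * m) = (real n)\<^sup>2 - 8 * (m * real n) + 7 * (m * m)"
      by (simp add: algebra_simps power2_eq_square)
    ultimately show ?thesis by linarith
  qed
  also have "\<dots> = 3 * real q * real q - 3 * real q * m"
    unfolding q_eq by (simp add: field_simps)
  also have "\<dots> \<le> real (num_ordinary A)"
  proof -
    have "real (3 * q * q) \<le> real (num_ordinary A + 3 * q * card E)"
      using A(2) by (rule of_nat_mono)
    then show ?thesis by (simp add: m_def)
  qed
  also have "\<dots> \<le> real_of_int (F r k n)"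
    using F_ge[OF A(1)] by linarith
  finally show ?thesis .
qed

end
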